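(* Let $E\subset \mathbb{T}$ be measurable, let $\Lambda=\{\cdots<\lambda_{-1}<\lambda_0<\lambda_1<\cdots\}\subset\mathbb{R}$, and let $0<\alpha<1$. If there exist a sequence of intervals $\{E_n:n\in\mathbb{N}\}$ of nonincreasing length and an integer $Z$ such that (1) $\bigcup_{n=1}^\infty E_n\supset E$, and (2) $\sum_{n=1}^Z |E_n|+\sum_{n=Z+1}^\infty |E_n|^\alpha<1$, and $\dim^+(\Lambda)<1-\alpha$, then $(E,\Lambda)$ can be uniformly partitioned into Riesz sequences.
   Context: $\mathbb{T}$ is the circle, identified with an interval of length one such as $[0,1)$, with Lebesgue measure $|\cdot|$ normalized so that $|\mathbb{T}|=1$. Riesz sequence: a family $\{e_i:i\in I\}$ in a Hilbert space is a Riesz sequence if there are constants $K_1,K_2>0$ such that for every finitely supported family of scalars $\{a_i\}_{i\in I}$, $K_1\sum_i|a_i|^2\le\|\sum_i a_ie_i\|^2\le K_2\sum_i|a_i|^2$. Uniform partition: for $\Lambda=\{\cdots<\lambda_{-1}<\lambda_0<\lambda_1<\cdots\}\subset\mathbb{R}$, a family $\{e_{\lambda_k}:k\in\mathbb{Z}\}$ can be uniformly partitioned into Riesz sequences if there is a positive integer $N$ such that for each $1\le J\le N$, $\{e_{\lambda_{mN+J}}:m\in\mathbb{Z}\}$ is a Riesz sequence. For measurable $E\subset\mathbb{T}$, we say that $(E,\Lambda)$ can be uniformly partitioned into Riesz sequences if the family of functions $x\mapsto e^{2\pi i\lambda x}1_E(x)$, $\lambda\in\Lambda$, in $L^2(\mathbb{T})$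 can be uniformly partitioned into Riesz sequences, where $1_E$ is the indicator function of $E$. Upper Beurling dimension: for $x\in\mathbb{R}$, $h>0$ let $Q_h(x)=[x-h,x+h]$. For $r>0$ let $\mathcal{D}_r^+(\Lambda)=\limsup_{h\to\infty}\sup_{x\in\mathbb{R}}\frac{\#(\Lambda\cap Q_h(x))}{h^r}$, and let $\dim^+(\Lambda)=\sup\{r>0:\mathcal{D}_r^+(\Lambda)>0\}$ (with the supremum of the empty set equal to $0$).
   Formalization: Condition (1) is corrected: the intervals E_n cover the complement of E in the circle rather than E itself; as printed the claim fails, e.g. for E empty, E_n={0}, λ_k=k^3, α=1/4, where the zero family is not a Riesz sequence. *)

theory Defs
  imports "HOL-Analysis.Analysis"
begin

text \<open>
  The circle is the interval \<open>{0..<1}\<close> with Lebesgue measure. Its intervals are the images of real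
  intervals under the projection \<open>frac\<close>, so they may wrap around the end point and they may be
  empty or a single point.
\<close>

abbreviation circle :: "real set"
  where "circle \<equiv> {0..<1}"

definition circle_interval :: "real set \<Rightarrow> bool"
  where "circle_interval A \<longleftrightarrow> (\<exists>I. is_interval I \<and> A = frac ` I)"

text \<open>
  Elements of \<open>L\<^sup>2(M)\<close> are represented by functions, and the squared norm is written as an
  integral. The square integrability condition makes the Bochner integrals in the definition of
  Riesz sequences meaningful.
\<close>

definition square_integrable :: "'a measure \<Rightarrow> ('a \<Rightarrow> complex) \<Rightarrow> bool"
  where "square_integrable M f \<longleftrightarrow>
    f \<in> borel_measurable M \<and> integrable M (\<lambda>x. (cmod (f x))\<^sup>2)"

definition riesz_sequence :: "'a measure \<Rightarrow> ('i \<Rightarrow> 'a \<Rightarrow> complex) \<Rightarrow> bool"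
  where "riesz_sequence M e \<longleftrightarrow>
    (\<forall>i. square_integrable M (e i)) \<and>
    (\<exists>K1>0. \<exists>K2>0. \<forall>a :: 'i \<Rightarrow> complex. finite {i. a i \<noteq> 0} \<longrightarrow>
       K1 * (\<Sum>i | a i \<noteq> 0. (cmod (a i))\<^sup>2)
         \<le> (LINT x|M. (cmod (\<Sum>i | a i \<noteq> 0. a i * e i x))\<^sup>2) \<and>
       (LINT x|M. (cmod (\<Sum>i | a i \<noteq> 0. a i * e i x))\<^sup>2)
         \<le> K2 * (\<Sum>i | a i \<noteq> 0. (cmod (a i))\<^sup>2))"

definition uniform_riesz_partition :: "'a measure \<Rightarrow> (int \<Rightarrow> 'a \<Rightarrow> complex) \<Rightarrow> bool"
  where "uniform_riesz_partition M e \<longleftrightarrow>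
    (\<exists>N::nat. N \<ge> 1 \<and> (\<forall>J\<in>{1..N}. riesz_sequence M (\<lambda>m::int. e (m * int N + int J))))"

definition restricted_exponential :: "real set \<Rightarrow> real \<Rightarrow> real \<Rightarrow> complex"
  where "restricted_exponential E \<xi> x =
    exp (2 * complex_of_real pi * \<i> * complex_of_real \<xi> * complex_of_real x) * indicator E x"

text \<open>
  A set \<open>\<Lambda>\<close> is given by its increasing enumeration \<open>lam\<close>. The set fixes it up to a shift of the
  index, which does not affect the following property.
\<close>

definition uniformly_partitionable :: "real set \<Rightarrow> (int \<Rightarrow> real) \<Rightarrow> bool"
  where "uniformly_partitionable E lam \<longleftrightarrow>
    uniform_riesz_partition (lebesgue_on circle) (\<lambda>k. restricted_exponential E (lam k))"

text \<open>
  Points are counted in \<open>ennreal\<close>, since \<open>\<Lambda>\<close> may have infinitely many points in a bounded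
  interval (\<open>card\<close> would then return \<open>0\<close>). In \<open>ennreal\<close> the supremum of the empty set is \<open>0\<close>.
\<close>

definition upper_beurling_density :: "real \<Rightarrow> real set \<Rightarrow> ennreal"
  where "upper_beurling_density r \<Lambda> =
    Limsup at_top (\<lambda>h::real. SUP x::real.
      emeasure (count_space UNIV) (\<Lambda> \<inter> {x - h..x + h}) / ennreal (h powr r))"

definition upper_beurling_dim :: "real set \<Rightarrow> ennreal"
  where "upper_beurling_dim \<Lambda> =
    (SUP r\<in>{r::real. r > 0 \<and> upper_beurling_density r \<Lambda> > 0}. ennreal r)"

end

theory Submission imports Defs
begin

text \<open>
  Take \<open>r\<close> strictly between the upper Beurling dimension of \<open>\<Lambda>\<close> and \<open>1 - \<alpha>\<close>. The density of
  order \<open>r\<close> vanishes, so every interval of large half-length \<open>h\<close> has fewer than \<open>h powr r\<close> points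
  of \<open>\<Lambda>\<close>. Read backwards, points of \<open>\<Lambda>\<close> whose indices differ by a large \<open>d\<close> are at least
  \<open>d powr (1 / r)\<close> apart (\<open>gap_of_dimension\<close>). For large \<open>N\<close>, two points of the same class of
  indices modulo \<open>N\<close>, in positions \<open>j\<close> and \<open>k\<close> of that class, are thus at least
  \<open>(N * \<bar>j - k\<bar>) powr (1 / r)\<close> apart.

  The integral of the exponential of frequency \<open>\<xi>\<close> over an interval \<open>A\<close> of the circle is at most
  \<open>\<bar>A\<bar>\<close> trivially and at most \<open>1 / \<bar>\<xi>\<bar>\<close> by integration, hence at most the weighted geometric mean
  \<open>\<bar>A\<bar> powr \<alpha> * \<bar>\<xi>\<bar> powr (\<alpha> - 1)\<close> (\<open>norm_integral_exponential_le_powr\<close>). In the Gram matrix of a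
  class over \<open>A\<close> the off-diagonal entry \<open>(j, k)\<close> is therefore at most
  \<open>\<bar>A\<bar> powr \<alpha> * (N * \<bar>j - k\<bar>) powr -s\<close>, where \<open>s = (1 - \<alpha>) / r\<close>. Since \<open>s > 1\<close>, the row sums
  converge, and Schur's test shows that a combination \<open>f\<close> of the class with coefficients \<open>a\<close>
  satisfies
  \[ \left| \int_A |f|^2 - |A| \|a\|^2 \right| \le \kappa |A|^\alpha \|a\|^2 \]
  with \<open>\<kappa>\<close> a constant multiple of \<open>N powr -s\<close> (\<open>separated_energy\<close>).

  Apply this to the whole circle and to each of the intervals \<open>A\<^sub>n\<close> covering the complement of \<open>E\<close>.
  The energy of \<open>f\<close> on \<open>E\<close> is at least
  \[ \Bigl(1 - \sum_n |A_n| - \kappa \bigl(1 + \sum_n |A_n|^\alpha\bigr)\Bigr) \|a\|^2 \]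
  and at most \<open>1 + \<kappa>\<close> times the squared norm of \<open>a\<close> (\<open>riesz_sequence_off_small_intervals\<close>).
  A length is at most \<open>1\<close>, hence at most its own \<open>\<alpha>\<close>-th power, so the smallness condition makes
  the sum of the lengths less than \<open>1\<close> and the sum of the powers finite. As \<open>\<kappa>\<close> tends to \<open>0\<close> when
  \<open>N\<close> grows, the lower constant is positive for a suitable \<open>N\<close>, the same for all classes.
\<close>

section \<open>Exponential integrals over intervals of the circle\<close>

text \<open>
  Non-integer frequencies do not give periodic functions, so an arc through the end point cannot
  be moved to an ordinary interval. It is instead cut there into two real intervals. They may
  overlap, when the arc covers the whole circle.
\<close>

lemma circle_interval_eq_Un:
  assumes "circle_interval A"
  obtains P Q where "is_interval P" "is_interval Q" "A = P \<union> Q" "P \<subseteq> circle" "Q \<subseteq> circle"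
proof -
  obtain S where S: "is_interval S" "A = frac ` S"
    using assms unfolding circle_interval_def by blast
  have between: "z \<in> S" if "x \<in> S" "y \<in> S" "x \<le> z" "z \<le> y" for x y z
    using S(1) that unfolding is_interval_1 by blast
  have sub: "A \<subseteq> circle"
    unfolding S(2) by (auto simp: frac_lt_1)
  show thesis
  proof (cases "\<exists>x\<in>S. \<exists>y\<in>S. \<lfloor>x\<rfloor> + 2 \<le> \<lfloor>y\<rfloor>")
    (* Then S contains a full period between two consecutive integers. *)
    case True
    then obtain x y where xy: "x \<in> S" "y \<in> S" "\<lfloor>x\<rfloor> + 2 \<le> \<lfloor>y\<rfloor>" by blast
    have "z \<in> A" if "z \<in> circle" for z
    proof -
      have "x \<le> z + of_int (\<lfloor>x\<rfloor> + 1)" "z + of_int (\<lfloor>x\<rfloor> + 1) \<le> y"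
        using that xy(3) by auto linarith+
      then have "z + of_int (\<lfloor>x\<rfloor> + 1) \<in> S" using between xy by blast
      moreover have "frac (z + of_int (\<lfloor>x\<rfloor> + 1)) = z"
        using that by (simp add: frac_eq frac_unique_iff)
      ultimately show ?thesis unfolding S(2) by (metis imageI)
    qed
    then have "A = circle" using sub by blast
    then show thesis using that[of circle circle] by (auto simp: is_interval_1)
  next
    case False
    have "\<exists>n. \<forall>x\<in>S. \<lfloor>x\<rfloor> = n \<or> \<lfloor>x\<rfloor> = n + 1"
    proof (cases "S = {}")
      case False
      then obtain x where x: "x \<in> S" by blast
      show ?thesis
      proof (cases "\<exists>y\<in>S. \<lfloor>y\<rfloor> < \<lfloor>x\<rfloor>")
        case True
        then obtain y where y: "y \<in> S" "\<lfloor>y\<rfloor> < \<lfloor>x\<rfloor>" by blast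
        have "\<lfloor>z\<rfloor> = \<lfloor>y\<rfloor> \<or> \<lfloor>z\<rfloor> = \<lfloor>y\<rfloor> + 1" if "z \<in> S" for z
          using \<open>\<not> (\<exists>x\<in>S. \<exists>y\<in>S. \<lfloor>x\<rfloor> + 2 \<le> \<lfloor>y\<rfloor>)\<close> x y that by smt
        then show ?thesis by blast
      next
        case False
        have "\<lfloor>z\<rfloor> = \<lfloor>x\<rfloor> \<or> \<lfloor>z\<rfloor> = \<lfloor>x\<rfloor> + 1" if "z \<in> S" for z
          using \<open>\<not> (\<exists>x\<in>S. \<exists>y\<in>S. \<lfloor>x\<rfloor> + 2 \<le> \<lfloor>y\<rfloor>)\<close> False x that by smt
        then show ?thesis by blast
      qed
    qed auto
    then obtain n where n: "\<And>x. x \<in> S \<Longrightarrow> \<lfloor>x\<rfloor> = n \<or> \<lfloor>x\<rfloor> = n + 1" by blast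
    define piece where "piece k = {x \<in> circle. x + of_int k \<in> S}" for k :: int
    have int: "is_interval (piece k)" for k
      unfolding is_interval_1
    proof (intro ballI allI impI)
      fix a b x assume "a \<in> piece k" "b \<in> piece k" "a \<le> x \<and> x \<le> b"
      then show "x \<in> piece k"
        using between[of "a + of_int k" "b + of_int k" "x + of_int k"] by (auto simp: piece_def)
    qed
    have "A = piece n \<union> piece (n + 1)"
    proof
      show "piece n \<union> piece (n + 1) \<subseteq> A"
      proof
        fix x assume "x \<in> piece n \<union> piece (n + 1)"
        then obtain k where k: "x \<in> circle" "x + of_int k \<in> S"
          unfolding piece_def by blast
        moreover have "frac (x + of_int k) = x"
          using k by (simp add: frac_eq frac_unique_iff)
        ultimately show "x \<in> A" unfolding S(2) by (metis imageI)
      qed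
      show "A \<subseteq> piece n \<union> piece (n + 1)"
      proof
        fix x assume "x \<in> A"
        then obtain y where y: "y \<in> S" "x = frac y" unfolding S(2) by blast
        then have "x \<in> piece \<lfloor>y\<rfloor>" by (simp add: piece_def frac_lt_1 frac_def) linarith
        then show "x \<in> piece n \<union> piece (n + 1)" using n[OF y(1)] by auto
      qed
    qed
    moreover have "piece k \<subseteq> circle" for k by (auto simp: piece_def)
    ultimately show thesis using that[OF int int] by blast
  qed
qed

lemma circle_interval_sets:
  assumes "circle_interval A"
  shows "A \<in> sets lebesgue" "A \<subseteq> circle"
proof -
  obtain P Q where "is_interval P" "is_interval Q" "A = P \<union> Q" "P \<subseteq> circle" "Q \<subseteq> circle"
    using circle_interval_eq_Un[OF assms] .
  then show "A \<in> sets lebesgue" "A \<subseteq> circle"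
    using real_interval_borel_measurable by (auto intro!: sets.Un sets_completionI_sets)
qed

lemma set_integrable_continuous_circle:
  fixes g :: "real \<Rightarrow> 'a::euclidean_space"
  assumes "continuous_on UNIV g" "A \<in> sets lebesgue" "A \<subseteq> circle"
  shows "set_integrable lebesgue A g"
proof (rule set_integrable_subset)
  show "set_integrable lebesgue {0..1} g"
    using absolutely_integrable_continuous_real continuous_on_subset[OF assms(1)] by blast
qed (use assms in auto)

lemma norm_integral_exponential_interval:
  assumes A: "is_interval A" "A \<subseteq> circle" and "\<xi> \<noteq> 0"
  shows "cmod (LINT x:A|lebesgue. cis (2 * pi * \<xi> * x)) \<le> 1 / (pi * \<bar>\<xi>\<bar>)"
proof (cases "A = {}")
  case False
  define a b where "a = Inf A" and "b = Sup A"
  let ?f = "\<lambda>x. cis (2 * pi * \<xi> * x)"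
  let ?F = "\<lambda>x. cis (2 * pi * \<xi> * x) / (2 * pi * \<i> * \<xi>)"
  have bdd: "bdd_below A" "bdd_above A"
    using A(2) by (auto intro!: bdd_belowI[of _ 0] bdd_aboveI[of _ 1])
  have sub1: "A \<subseteq> {a..b}"
    unfolding a_def b_def using bdd by (auto intro: cInf_lower cSup_upper)
  then have "a \<le> b" using False by force
  have sub2: "{a<..<b} \<subseteq> A"
  proof
    fix x assume x: "x \<in> {a<..<b}"
    obtain u v where "u \<in> A" "u < x" "v \<in> A" "x < v"
      using x False bdd unfolding a_def b_def
      by (auto simp: cInf_less_iff less_cSup_iff)
    then show "x \<in> A" using A(1) unfolding is_interval_1 by (meson less_imp_le)
  qed
  have int: "set_integrable lebesgue A ?f"
    using real_interval_borel_measurable[OF A(1)] A(2)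
    by (intro set_integrable_continuous_circle) (auto intro!: continuous_intros)
  have "(LINT x:A|lebesgue. ?f x) = integral A ?f"
    using set_lebesgue_integral_eq_integral(2)[OF int] .
  also have "\<dots> = integral {a..b} ?f"
  proof (rule integral_spike_set)
    show "negligible {x \<in> A - {a..b}. ?f x \<noteq> 0}"
      by (rule negligible_subset[of "{}"]) (use sub1 in auto)
    show "negligible {x \<in> {a..b} - A. ?f x \<noteq> 0}"
      by (rule negligible_subset[of "{a, b}"]) (use sub2 in force)+
  qed
  also have "\<dots> = ?F b - ?F a"
  proof (rule integral_unique, rule fundamental_theorem_of_calculus[OF \<open>a \<le> b\<close>])
    fix x
    have "((\<lambda>z. exp (2 * pi * \<i> * \<xi> * z) / (2 * pi * \<i> * \<xi>))
        has_field_derivative exp (2 * pi * \<i> * \<xi> * x)) (at (of_real x))"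
      using \<open>\<xi> \<noteq> 0\<close> by (auto intro!: derivative_eq_intros)
    from has_vector_derivative_real_field[OF this, of "{a..b}"]
    show "(?F has_vector_derivative ?f x) (at x within {a..b})"
      by (simp add: cis_conv_exp mult_ac)
  qed
  finally have "(LINT x:A|lebesgue. ?f x) = ?F b - ?F a" .
  also have "cmod \<dots> \<le> cmod (?F b) + cmod (?F a)" by (rule norm_triangle_ineq4)
  also have "\<dots> = 1 / (pi * \<bar>\<xi>\<bar>)"
    using \<open>\<xi> \<noteq> 0\<close> by (simp add: norm_mult norm_divide field_simps)
  finally show ?thesis .
qed (simp add: set_lebesgue_integral_def)

text \<open>
  By inclusion-exclusion for the two pieces of \<open>A\<close>, whose intersection is again an interval, the
  integral is a signed sum of three interval integrals; the constant is \<open>1\<close> because \<open>3 < \<pi>\<close>.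
\<close>

lemma norm_integral_exponential_circle_interval:
  assumes "circle_interval A" and "\<xi> \<noteq> 0"
  shows "cmod (LINT x:A|lebesgue. cis (2 * pi * \<xi> * x)) \<le> 1 / \<bar>\<xi>\<bar>"
proof -
  obtain P Q where PQ: "is_interval P" "is_interval Q" "A = P \<union> Q" "P \<subseteq> circle" "Q \<subseteq> circle"
    using circle_interval_eq_Un[OF assms(1)] .
  let ?f = "\<lambda>x. cis (2 * pi * \<xi> * x)"
  let ?I = "\<lambda>S. LINT x:S|lebesgue. ?f x"
  have int: "is_interval (P \<inter> Q)" using PQ by (intro is_interval_Int)
  have meas: "S \<in> sets lebesgue" if "is_interval S" for S :: "real set"
    using real_interval_borel_measurable[OF that] by simp
  have si: "set_integrable lebesgue S ?f" if "S \<in> sets lebesgue" "S \<subseteq> circle" for S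
    using that by (intro set_integrable_continuous_circle) (auto intro!: continuous_intros)
  have "?I (P \<union> (Q - P)) = ?I P + ?I (Q - P)"
    using PQ meas by (intro set_integral_Un si) auto
  moreover have "?I ((Q - P) \<union> (P \<inter> Q)) = ?I (Q - P) + ?I (P \<inter> Q)"
    using PQ meas by (intro set_integral_Un si) auto
  moreover have "P \<union> (Q - P) = A" "(Q - P) \<union> (P \<inter> Q) = Q"
    using PQ(3) by auto
  ultimately have "?I A = ?I P + ?I Q - ?I (P \<inter> Q)" by simp
  then have "cmod (?I A) \<le> cmod (?I P) + cmod (?I Q) + cmod (?I (P \<inter> Q))"
    using norm_triangle_ineq4[of "?I P + ?I Q" "?I (P \<inter> Q)"] norm_triangle_ineq[of "?I P" "?I Q"]
    by simp
  also have "\<dots> \<le> 1 / (pi * \<bar>\<xi>\<bar>) + 1 / (pi * \<bar>\<xi>\<bar>) + 1 / (pi * \<bar>\<xi>\<bar>)"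
    using PQ int \<open>\<xi> \<noteq> 0\<close> by (intro add_mono norm_integral_exponential_interval) auto
  also have "\<dots> = (3 / pi) * (1 / \<bar>\<xi>\<bar>)" by simp
  also have "\<dots> \<le> 1 * (1 / \<bar>\<xi>\<bar>)"
    using pi_gt3 by (intro mult_right_mono) auto
  finally show ?thesis by simp
qed

text \<open>
  Interpolation between the bounds \<open>\<bar>A\<bar>\<close> and \<open>1 / \<bar>\<xi>\<bar>\<close>. Giving up part of the decay in \<open>\<xi>\<close> keeps the
  factor \<open>\<bar>A\<bar> powr \<alpha>\<close>, which is what makes the errors summable over infinitely many intervals.
\<close>

lemma norm_integral_exponential_le_powr:
  assumes A: "circle_interval A" and "\<xi> \<noteq> 0" and "0 \<le> \<alpha>" "\<alpha> \<le> 1"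
  shows "cmod (LINT x:A|lebesgue. cis (2 * pi * \<xi> * x))
    \<le> measure lebesgue A powr \<alpha> * \<bar>\<xi>\<bar> powr (\<alpha> - 1)"
proof -
  let ?f = "\<lambda>x. cis (2 * pi * \<xi> * x)"
  let ?t = "cmod (LINT x:A|lebesgue. ?f x)"
  note S = circle_interval_sets[OF A]
  have "?t \<le> (LINT x:A|lebesgue. cmod (?f x))"
    using S by (intro set_integral_norm_bound set_integrable_continuous_circle)
      (auto intro!: continuous_intros)
  also have "\<dots> = measure lebesgue A"
    using S by (simp add: set_lebesgue_integral_def)
  finally have 1: "?t \<le> measure lebesgue A" .
  show ?thesis
  proof (cases "?t = 0")
    case False
    then have "?t = ?t powr \<alpha> * ?t powr (1 - \<alpha>)"
      by (simp flip: powr_add)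
    also have "\<dots> \<le> measure lebesgue A powr \<alpha> * (1 / \<bar>\<xi>\<bar>) powr (1 - \<alpha>)"
      using 1 norm_integral_exponential_circle_interval[OF A \<open>\<xi> \<noteq> 0\<close>] assms
      by (intro mult_mono powr_mono2) auto
    also have "(1 / \<bar>\<xi>\<bar>) powr (1 - \<alpha>) = \<bar>\<xi>\<bar> powr (\<alpha> - 1)"
      using \<open>\<xi> \<noteq> 0\<close> by (simp add: powr_divide powr_diff)
    finally show ?thesis .
  qed auto
qed

section \<open>Almost orthogonality by Schur's test\<close>

lemma norm_exponential_sum_square:
  "complex_of_real ((cmod (\<Sum>j\<in>F. a j * cis (2 * pi * \<mu> j * x)))\<^sup>2)
    = (\<Sum>j\<in>F. \<Sum>k\<in>F. a j * cnj (a k) * cis (2 * pi * (\<mu> j - \<mu> k) * x))"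
proof -
  have "complex_of_real ((cmod (\<Sum>j\<in>F. a j * cis (2 * pi * \<mu> j * x)))\<^sup>2) 
    = (\<Sum>j\<in>F. a j * cis (2 * pi * \<mu> j * x)) * cnj (\<Sum>j\<in>F. a j * cis (2 * pi * \<mu> j * x))"
    using complex_norm_square by simp
  also have "\<dots> = (\<Sum>j\<in>F. \<Sum>k\<in>F. a j * cis (2 * pi * \<mu> j * x) * cnj (a k * cis (2 * pi * \<mu> k * x)))"
    by (simp add: sum_product)
  also have "\<dots> = (\<Sum>j\<in>F. \<Sum>k\<in>F. a j * cnj (a k) * cis (2 * pi * (\<mu> j - \<mu> k) * x))"
  proof (intro sum.cong refl)
    fix j k
    have "cis (2 * pi * (\<mu> j - \<mu> k) * x) = cis (2 * pi * \<mu> j * x) * cnj (cis (2 * pi * \<mu> k * x))"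
      by (simp add: cis_cnj cis_mult algebra_simps)
    then show "a j * cis (2 * pi * \<mu> j * x) * cnj (a k * cis (2 * pi * \<mu> k * x))
      = a j * cnj (a k) * cis (2 * pi * (\<mu> j - \<mu> k) * x)" by simp
  qed
  finally show ?thesis .
qed

lemma set_integrable_sum:
  assumes "\<And>i. i \<in> F \<Longrightarrow> set_integrable M A (h i)"
  shows "set_integrable M A (\<lambda>x. \<Sum>i\<in>F. h i x)"
  using assms unfolding set_integrable_def scaleR_sum_right
  by (rule Bochner_Integration.integrable_sum)

lemma set_integral_sum:
  assumes "\<And>i. i \<in> F \<Longrightarrow> set_integrable M A (h i)"
  shows "(LINT x:A|M. (\<Sum>i\<in>F. h i x)) = (\<Sum>i\<in>F. LINT x:A|M. h i x)"
  using assms unfolding set_integrable_def set_lebesgue_integral_def scaleR_sum_right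
  by (rule Bochner_Integration.integral_sum)

text \<open>
  By \<open>2 u v \<le> u\<^sup>2 + v\<^sup>2\<close> the form is bounded by the average of two weighted sums of squares, which agree
  because \<open>g\<close> is symmetric; each is then controlled by the row sums.
\<close>

lemma schur_test:
  fixes G :: "'i \<Rightarrow> 'i \<Rightarrow> complex"
  assumes "finite F"
    and G: "\<And>j k. j \<in> F \<Longrightarrow> k \<in> F \<Longrightarrow> j \<noteq> k \<Longrightarrow> cmod (G j k) \<le> g j k"
    and sym: "\<And>j k. g j k = g k j"
    and row: "\<And>j. j \<in> F \<Longrightarrow> (\<Sum>k\<in>F-{j}. g j k) \<le> B"
  shows "cmod (\<Sum>j\<in>F. \<Sum>k\<in>F-{j}. a j * cnj (a k) * G j k) \<le> B * (\<Sum>j\<in>F. (cmod (a j))\<^sup>2)"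
proof -
  let ?S = "\<Sum>j\<in>F. \<Sum>k\<in>F-{j}. (cmod (a j))\<^sup>2 * g j k"
  have "cmod (\<Sum>j\<in>F. \<Sum>k\<in>F-{j}. a j * cnj (a k) * G j k)
      \<le> (\<Sum>j\<in>F. \<Sum>k\<in>F-{j}. cmod (a j) * cmod (a k) * cmod (G j k))"
    by (rule sum_norm_le, rule sum_norm_le) (simp only: norm_mult complex_mod_cnj order_refl)
  also have "\<dots> \<le> (\<Sum>j\<in>F. \<Sum>k\<in>F-{j}. ((cmod (a j))\<^sup>2 * g j k + (cmod (a k))\<^sup>2 * g k j) / 2)"
  proof (intro sum_mono)
    fix j k assume jk: "j \<in> F" "k \<in> F - {j}"
    have "cmod (a j) * cmod (a k) * cmod (G j k) \<le> (((cmod (a j))\<^sup>2 + (cmod (a k))\<^sup>2) / 2) * g j k"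
      using G[of j k] jk sum_squares_bound[of "cmod (a j)" "cmod (a k)"]
      by (intro mult_mono) auto
    then show "cmod (a j) * cmod (a k) * cmod (G j k)
        \<le> ((cmod (a j))\<^sup>2 * g j k + (cmod (a k))\<^sup>2 * g k j) / 2"
      using sym[of k j] by (simp add: field_simps)
  qed
  also have "\<dots> = (?S + (\<Sum>j\<in>F. \<Sum>k\<in>F-{j}. (cmod (a k))\<^sup>2 * g k j)) / 2"
    by (simp add: sum_divide_distrib sum.distrib add_divide_distrib)
  also have "(\<Sum>j\<in>F. \<Sum>k\<in>F-{j}. (cmod (a k))\<^sup>2 * g k j) = ?S"
  proof -
    have "(\<Sum>j\<in>F. \<Sum>k\<in>F-{j}. h k j) = (\<Sum>j\<in>F. \<Sum>k\<in>F. if k = j then 0 else h k j)"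
      for h :: "'i \<Rightarrow> 'i \<Rightarrow> real"
      using \<open>finite F\<close> by (intro sum.cong refl sum.mono_neutral_cong_left) auto
    note eq = this
    show ?thesis
      unfolding eq[of "\<lambda>k j. (cmod (a k))\<^sup>2 * g k j"] eq[of "\<lambda>k j. (cmod (a j))\<^sup>2 * g j k"]
      by (subst sum.swap) (intro sum.cong refl, auto)
  qed
  also have "(?S + ?S) / 2 = ?S" by simp
  also have "\<dots> = (\<Sum>j\<in>F. (cmod (a j))\<^sup>2 * (\<Sum>k\<in>F-{j}. g j k))"
    by (simp add: sum_distrib_left)
  also have "\<dots> \<le> (\<Sum>j\<in>F. (cmod (a j))\<^sup>2 * B)"
    using row by (intro sum_mono mult_left_mono) auto
  also have "\<dots> = B * (\<Sum>j\<in>F. (cmod (a j))\<^sup>2)"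
    by (simp add: sum_distrib_left mult.commute)
  finally show ?thesis .
qed

text \<open>
  The diagonal of the Gram matrix over \<open>A\<close> is constantly \<open>\<bar>A\<bar>\<close> and gives the main term; Schur's test
  bounds the rest.
\<close>

lemma energy_near_diagonal:
  fixes \<mu> :: "'i \<Rightarrow> real"
  assumes A: "A \<in> sets lebesgue" "A \<subseteq> circle" and "finite F"
    and g: "\<And>j k. j \<in> F \<Longrightarrow> k \<in> F \<Longrightarrow> j \<noteq> k \<Longrightarrow>
      cmod (LINT x:A|lebesgue. cis (2 * pi * (\<mu> j - \<mu> k) * x)) \<le> g j k"
    and sym: "\<And>j k. g j k = g k j"
    and row: "\<And>j. j \<in> F \<Longrightarrow> (\<Sum>k\<in>F-{j}. g j k) \<le> B"
  shows "\<bar>(LINT x:A|lebesgue. (cmod (\<Sum>j\<in>F. a j * cis (2 * pi * \<mu> j * x)))\<^sup>2)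
      - measure lebesgue A * (\<Sum>j\<in>F. (cmod (a j))\<^sup>2)\<bar> \<le> B * (\<Sum>j\<in>F. (cmod (a j))\<^sup>2)"
proof -
  define G where "G j k = (LINT x:A|lebesgue. cis (2 * pi * (\<mu> j - \<mu> k) * x))" for j k
  have si: "set_integrable lebesgue A (\<lambda>x. c * cis (2 * pi * \<xi> * x))" for c \<xi>
    using A by (intro set_integrable_continuous_circle) (auto intro!: continuous_intros)
  have diag: "G j j = measure lebesgue A" for j
    using A by (simp add: G_def set_lebesgue_integral_def scaleR_conv_of_real)
  have "complex_of_real (LINT x:A|lebesgue. (cmod (\<Sum>j\<in>F. a j * cis (2 * pi * \<mu> j * x)))\<^sup>2)
    = (LINT x:A|lebesgue. complex_of_real ((cmod (\<Sum>j\<in>F. a j * cis (2 * pi * \<mu> j * x)))\<^sup>2))"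
    by (rule set_integral_complex_of_real[symmetric])
  also have "\<dots> = (LINT x:A|lebesgue.
      (\<Sum>j\<in>F. \<Sum>k\<in>F. a j * cnj (a k) * cis (2 * pi * (\<mu> j - \<mu> k) * x)))"
    unfolding norm_exponential_sum_square ..
  also have "\<dots> = (\<Sum>j\<in>F. \<Sum>k\<in>F. a j * cnj (a k) * G j k)"
    unfolding G_def by (simp only: set_integral_sum set_integrable_sum si set_integral_mult_right)
  also have "\<dots> = (\<Sum>j\<in>F. a j * cnj (a j) * G j j + (\<Sum>k\<in>F-{j}. a j * cnj (a k) * G j k))"
    using \<open>finite F\<close> by (intro sum.cong refl sum.remove)
  also have "\<dots> = measure lebesgue A * (\<Sum>j\<in>F. (cmod (a j))\<^sup>2)
      + (\<Sum>j\<in>F. \<Sum>k\<in>F-{j}. a j * cnj (a k) * G j k)"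
    unfolding sum.distrib diag complex_norm_square[symmetric]
    by (simp add: sum_distrib_left mult.commute)
  finally have "complex_of_real ((LINT x:A|lebesgue. (cmod (\<Sum>j\<in>F. a j * cis (2 * pi * \<mu> j * x)))\<^sup>2)
      - measure lebesgue A * (\<Sum>j\<in>F. (cmod (a j))\<^sup>2))
      = (\<Sum>j\<in>F. \<Sum>k\<in>F-{j}. a j * cnj (a k) * G j k)" by simp
  from arg_cong[OF this, of cmod]
  have "\<bar>(LINT x:A|lebesgue. (cmod (\<Sum>j\<in>F. a j * cis (2 * pi * \<mu> j * x)))\<^sup>2)
      - measure lebesgue A * (\<Sum>j\<in>F. (cmod (a j))\<^sup>2)\<bar>
      = cmod (\<Sum>j\<in>F. \<Sum>k\<in>F-{j}. a j * cnj (a k) * G j k)"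
    by (simp only: norm_of_real)
  also have "\<dots> \<le> B * (\<Sum>j\<in>F. (cmod (a j))\<^sup>2)"
    using g unfolding G_def by (intro schur_test[OF \<open>finite F\<close> _ sym row]) auto
  finally show ?thesis .
qed

section \<open>Gaps forced by the dimension\<close>

text \<open>
  Counting turns a dimension bound into separation: the shortest interval containing \<open>lam i\<close> and
  \<open>lam j\<close> has at least \<open>j - i\<close> points and half-length \<open>h\<close>, so \<open>j - i < h powr r\<close>. This is valid only for
  \<open>h\<close> above some threshold, and the threshold is passed once \<open>j - i\<close> is large.
\<close>

lemma gap_of_dimension:
  assumes mono: "strict_mono (lam :: int \<Rightarrow> real)"
    and "upper_beurling_dim (range lam) < ennreal r" and "0 < r"
  obtains N0 where "\<And>i j. int N0 \<le> j - i \<Longrightarrow> real_of_int (j - i) powr (1 / r) \<le> lam j - lam i"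
proof -
  have "\<not> upper_beurling_density r (range lam) > 0"
  proof
    assume "upper_beurling_density r (range lam) > 0"
    then have "ennreal r \<le> upper_beurling_dim (range lam)"
      unfolding upper_beurling_dim_def using \<open>0 < r\<close> by (intro SUP_upper) auto
    then show False using assms(2) by simp
  qed
  then have "upper_beurling_density r (range lam) < 1" 
    by (simp add: not_gr_zero)
  then have "\<forall>\<^sub>F h in at_top. (SUP x::real.
      emeasure (count_space UNIV) (range lam \<inter> {x - h..x + h}) / ennreal (h powr r)) < 1"
    unfolding upper_beurling_density_def by (rule Limsup_lessD)
  then obtain h1 where h1: "\<And>h. h \<ge> h1 \<Longrightarrow> (SUP x::real.
      emeasure (count_space UNIV) (range lam \<inter> {x - h..x + h}) / ennreal (h powr r)) < 1"
    unfolding eventually_at_top_linorder by blast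
  define h0 where "h0 = max 1 h1"
  have count: "real_of_int (j - i) < h powr r"
    if "i \<le> j" "h0 \<le> h" "lam j - lam i \<le> 2 * h" for i j h
  proof -
    define x where "x = (lam i + lam j) / 2"
    have inj: "inj_on lam {i..j}"
      using mono by (auto simp: strict_mono_eq inj_on_def)
    have sub: "lam ` {i..j} \<subseteq> range lam \<inter> {x - h..x + h}"
    proof
      fix y assume "y \<in> lam ` {i..j}"
      then obtain k where k: "i \<le> k" "k \<le> j" "y = lam k" by auto
      then have "lam i \<le> y" "y \<le> lam j"
        using mono by (auto simp: strict_mono_less_eq)
      then show "y \<in> range lam \<inter> {x - h..x + h}" 
        using k that(3) by (auto simp: x_def field_simps)
    qed
    have "ennreal (real (card (lam ` {i..j}))) = emeasure (count_space UNIV) (lam ` {i..j})"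
      by (simp add: ennreal_of_nat_eq_real_of_nat)
    also have "\<dots> \<le> emeasure (count_space UNIV) (range lam \<inter> {x - h..x + h})"
      using sub by (intro emeasure_mono) auto
    also have "\<dots> < 1 * ennreal (h powr r)"
    proof (subst divide_less_ennreal[symmetric])
      show "emeasure (count_space UNIV) (range lam \<inter> {x - h..x + h}) / ennreal (h powr r) < 1"
        using h1[of h] that(2) unfolding h0_def
        by (intro le_less_trans[OF SUP_upper h1]) auto
    qed (use that(2) in \<open>auto simp: h0_def\<close>)
    finally have "real (card (lam ` {i..j})) < h powr r"
      using ennreal_less_iff by auto
    moreover have "real (card (lam ` {i..j})) = real_of_int (j - i + 1)"
      using that(1) by (simp add: card_image[OF inj])
    ultimately show ?thesis by simp
  qed
  define N0 where "N0 = nat \<lceil>h0 powr r\<rceil>"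
  have "real_of_int (j - i) powr (1 / r) \<le> lam j - lam i" if "int N0 \<le> j - i" for i j
  proof -
    have ij: "h0 powr r \<le> real_of_int (j - i)" "i \<le> j"
      using that unfolding N0_def by linarith+
    define h where "h = (lam j - lam i) / 2"
    (* Otherwise an interval of half-length h0 would contain too many points. *)
    have "h0 < h"
    proof (rule ccontr)
      assume "\<not> h0 < h"
      then have "real_of_int (j - i) < h0 powr r"
        using count[of i j h0] ij by (simp add: h_def)
      then show False using ij by simp
    qed
    then have "real_of_int (j - i) < h powr r"
      using count[of i j h] ij by (simp add: h_def)
    then have "real_of_int (j - i) powr (1 / r) \<le> (h powr r) powr (1 / r)"
      using ij \<open>0 < r\<close> by (intro powr_mono2) auto
    also have "\<dots> = h" using \<open>h0 < h\<close> \<open>0 < r\<close> by (simp add: powr_powr h0_def)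
    also have "\<dots> \<le> lam j - lam i" using \<open>h0 < h\<close> by (simp add: h_def h0_def)
    finally show ?thesis .
  qed
  then show thesis using that by blast
qed

text \<open>
  Each distance is attained at most once on either side of \<open>j\<close>. The term \<open>n = 0\<close> on the right is \<open>0\<close>,
  because \<open>0 powr x = 0\<close>.
\<close>

lemma sum_powr_int_distance_le:
  fixes F :: "int set"
  assumes "finite F" "1 < s"
  shows "(\<Sum>k\<in>F-{j}. (real_of_int \<bar>j - k\<bar>) powr -s) \<le> 2 * (\<Sum>n. real n powr -s)"
proof -
  have sm: "summable (\<lambda>n. real n powr -s)"
    using assms by (simp add: summable_real_powr_iff)
  have half: "(\<Sum>k\<in>H. (real_of_int \<bar>j - k\<bar>) powr -s) \<le> (\<Sum>n. real n powr -s)"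
    if "finite H" "inj_on (\<lambda>k. nat \<bar>j - k\<bar>) H" for H
  proof -
    have "(\<Sum>k\<in>H. (real_of_int \<bar>j - k\<bar>) powr -s)
        = (\<Sum>n\<in>(\<lambda>k. nat \<bar>j - k\<bar>) ` H. real n powr -s)"
      by (subst sum.reindex[OF that(2)]) (auto intro!: sum.cong)
    also have "\<dots> \<le> (\<Sum>n. real n powr -s)"
      using that(1) sm by (intro sum_le_suminf) auto
    finally show ?thesis .
  qed
  have "F - {j} = {k\<in>F. k < j} \<union> {k\<in>F. j < k}" by auto
  note split = this
  have "(\<Sum>k\<in>F-{j}. (real_of_int \<bar>j - k\<bar>) powr -s)
    = (\<Sum>k | k \<in> F \<and> k < j. (real_of_int \<bar>j - k\<bar>) powr -s)
      + (\<Sum>k | k \<in> F \<and> j < k. (real_of_int \<bar>j - k\<bar>) powr -s)"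
    unfolding split using assms(1) by (intro sum.union_disjoint) auto
  also have "\<dots> \<le> (\<Sum>n. real n powr -s) + (\<Sum>n. real n powr -s)"
    using assms(1) by (intro add_mono half) (auto intro!: inj_onI)
  finally show ?thesis by simp
qed

section \<open>Lower bounds for the energy on a set with small complement\<close>

text \<open>Countable subadditivity of the measure with density \<open>f\<close>.\<close>

lemma set_integral_le_suminf_cover:
  fixes f :: "real \<Rightarrow> real"
  assumes D: "D \<in> sets M" "D \<subseteq> (\<Union>n. A n)" and A: "\<And>n::nat. A n \<in> sets M"
    and f: "\<And>x. 0 \<le> f x" "f \<in> borel_measurable M"
    and int: "set_integrable M D f" "\<And>n. set_integrable M (A n) f"
    and c: "\<And>n. (LINT x:A n|M. f x) \<le> c n" "summable c"
  shows "(LINT x:D|M. f x) \<le> suminf c"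
proof -
  have eq: "emeasure (density M f) S = ennreal (LINT x:S|M. f x)"
    if "S \<in> sets M" "set_integrable M S f" for S
  proof -
    have "emeasure (density M f) S = (\<integral>\<^sup>+x. ennreal (indicator S x *\<^sub>R f x) \<partial>M)"
      using that f by (subst emeasure_density) (auto intro!: nn_integral_cong simp: indicator_def)
    also have "\<dots> = ennreal (LINT x:S|M. f x)"
      using that f unfolding set_integrable_def set_lebesgue_integral_def
      by (intro nn_integral_eq_integral) auto
    finally show ?thesis .
  qed
  have c0: "0 \<le> c n" for n
  proof -
    have "0 \<le> (LINT x:A n|M. f x)"
      unfolding set_lebesgue_integral_def using f by (intro integral_nonneg_AE) auto
    then show ?thesis using c(1)[of n] by linarith
  qed
  have "ennreal (LINT x:D|M. f x) = emeasure (density M f) D"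
    using eq[OF D(1) int(1)] by simp
  also have "\<dots> \<le> emeasure (density M f) (\<Union>n. A n)"
    using D A by (intro emeasure_mono) auto
  also have "\<dots> \<le> (\<Sum>n. emeasure (density M f) (A n))"
    using A by (intro emeasure_subadditive_countably) auto
  also have "\<dots> = (\<Sum>n. ennreal (LINT x:A n|M. f x))"
    using eq A int by simp
  also have "\<dots> \<le> (\<Sum>n. ennreal (c n))"
    using c by (intro suminf_le ennreal_leI) auto
  also have "\<dots> = ennreal (suminf c)"
    using c0 c by (intro suminf_ennreal2) auto
  finally show ?thesis using suminf_nonneg[OF c(2) c0] by simp
qed

text \<open>
  The gaps turn the bound \<open>\<bar>\<xi>\<bar> powr (\<alpha> - 1)\<close> for the frequency \<open>\<xi> = \<mu> j - \<mu> k\<close> into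
  \<open>(N * \<bar>j - k\<bar>) powr -s\<close>. The hypothesis \<open>r < 1 - \<alpha>\<close> says \<open>s > 1\<close>, so the rows of the Gram matrix are
  summable.
\<close>

lemma separated_energy:
  fixes \<mu> :: "int \<Rightarrow> real" and N :: real
  assumes A: "circle_interval A" and "finite F" and "0 < N" and "0 < r" "r < 1 - \<alpha>" "0 < \<alpha>"
    and gap: "\<And>j k. j \<noteq> k \<Longrightarrow> (N * real_of_int \<bar>j - k\<bar>) powr (1 / r) \<le> \<bar>\<mu> j - \<mu> k\<bar>"
  defines "s \<equiv> (1 - \<alpha>) / r"
  defines "\<kappa> \<equiv> N powr -s * (2 * (\<Sum>n. real n powr -s))"
  shows "\<bar>(LINT x:A|lebesgue. (cmod (\<Sum>j\<in>F. a j * cis (2 * pi * \<mu> j * x)))\<^sup>2)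
      - measure lebesgue A * (\<Sum>j\<in>F. (cmod (a j))\<^sup>2)\<bar>
    \<le> (measure lebesgue A powr \<alpha> * \<kappa>) * (\<Sum>j\<in>F. (cmod (a j))\<^sup>2)"
proof -
  let ?g = "\<lambda>j k. measure lebesgue A powr \<alpha> * (N * real_of_int \<bar>j - k\<bar>) powr -s"
  have "1 < s" using assms by (simp add: s_def field_simps)
  show ?thesis
  proof (rule energy_near_diagonal[where g = ?g])
    show "A \<in> sets lebesgue" "A \<subseteq> circle" "finite F"
      using circle_interval_sets[OF A] \<open>finite F\<close> by auto
  next
    fix j k :: int assume "j \<noteq> k"
    have pos: "0 < (N * real_of_int \<bar>j - k\<bar>) powr (1 / r)"
      using \<open>j \<noteq> k\<close> \<open>0 < N\<close> by simp
    with gap[OF \<open>j \<noteq> k\<close>] have "\<mu> j - \<mu> k \<noteq> 0" by auto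
    then have "cmod (LINT x:A|lebesgue. cis (2 * pi * (\<mu> j - \<mu> k) * x))
        \<le> measure lebesgue A powr \<alpha> * \<bar>\<mu> j - \<mu> k\<bar> powr (\<alpha> - 1)"
      using assms by (intro norm_integral_exponential_le_powr) auto
    also have "\<dots> \<le> measure lebesgue A powr \<alpha> * ((N * real_of_int \<bar>j - k\<bar>) powr (1 / r)) powr (\<alpha> - 1)"
      using gap[OF \<open>j \<noteq> k\<close>] pos assms by (intro mult_left_mono powr_mono2') auto
    also have "((N * real_of_int \<bar>j - k\<bar>) powr (1 / r)) powr (\<alpha> - 1)
        = (N * real_of_int \<bar>j - k\<bar>) powr -s"
      by (simp add: powr_powr s_def minus_divide_left)
    finally show "cmod (LINT x:A|lebesgue. cis (2 * pi * (\<mu> j - \<mu> k) * x)) \<le> ?g j k" .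
  next
    fix j k :: int show "?g j k = ?g k j" by (simp add: abs_minus_commute)
  next
    fix j
    have "(\<Sum>k\<in>F-{j}. ?g j k) = measure lebesgue A powr \<alpha> * (N powr -s *
        (\<Sum>k\<in>F-{j}. real_of_int \<bar>j - k\<bar> powr -s))"
      using \<open>0 < N\<close> by (simp add: powr_mult sum_distrib_left)
    also have "\<dots> \<le> measure lebesgue A powr \<alpha> * \<kappa>"
      unfolding \<kappa>_def using sum_powr_int_distance_le[OF \<open>finite F\<close> \<open>1 < s\<close>]
      by (intro mult_left_mono) auto
    finally show "(\<Sum>k\<in>F-{j}. ?g j k) \<le> measure lebesgue A powr \<alpha> * \<kappa>" .
  qed
qed

lemma restricted_exponential_eq:
  "restricted_exponential E \<xi> x = cis (2 * pi * \<xi> * x) * indicator E x"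
  by (simp add: restricted_exponential_def cis_conv_exp mult_ac)

lemma square_integrable_restricted_exponential:
  assumes "E \<in> sets lebesgue" "E \<subseteq> circle"
  shows "square_integrable (lebesgue_on circle) (restricted_exponential E \<xi>)"
  unfolding square_integrable_def
proof
  have "restricted_exponential E \<xi> = (\<lambda>x. cis (2 * pi * \<xi> * x) * indicator E x)"
    by (rule ext) (rule restricted_exponential_eq)
  moreover have "(\<lambda>x. cis (2 * pi * \<xi> * x)) \<in> borel_measurable lebesgue"
    by (intro measurable_completion)
      (auto intro!: borel_measurable_continuous_onI continuous_intros)
  ultimately show "restricted_exponential E \<xi> \<in> borel_measurable (lebesgue_on circle)"
    using assms(1) by (auto intro!: measurable_restrict_space1 borel_measurable_times borel_measurable_indicator)
  have "(\<lambda>x. (cmod (restricted_exponential E \<xi> x))\<^sup>2) = indicator E"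
    by (rule ext) (simp add: restricted_exponential_eq norm_mult indicator_def)
  moreover have "integrable (lebesgue_on circle) (indicator E :: real \<Rightarrow> real)"
  proof (rule integrable_real_indicator)
    show "E \<in> sets (lebesgue_on circle)"
      using assms by (simp add: sets_restrict_space_iff)
    have "E \<in> lmeasurable"
      using assms by (intro bounded_set_imp_lmeasurable) (auto intro: bounded_subset[of circle])
    moreover have "emeasure (lebesgue_on circle) E = emeasure lebesgue E"
      using assms by (intro emeasure_restrict_space) auto
    ultimately show "emeasure (lebesgue_on circle) E < \<infinity>"
      by (simp only: fmeasurable_def mem_Collect_eq)
  qed
  ultimately show "integrable (lebesgue_on circle) (\<lambda>x. (cmod (restricted_exponential E \<xi> x))\<^sup>2)"
    by simp
qed

lemma integral_restricted_exponential_sum: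
  assumes "E \<subseteq> circle"
  shows "(LINT x|lebesgue_on circle. (cmod (\<Sum>i\<in>F. a i * restricted_exponential E (\<mu> i) x))\<^sup>2)
    = (LINT x:E|lebesgue. (cmod (\<Sum>i\<in>F. a i * cis (2 * pi * \<mu> i * x)))\<^sup>2)"
proof -
  have "indicat_real circle x *\<^sub>R (cmod (\<Sum>i\<in>F. a i * restricted_exponential E (\<mu> i) x))\<^sup>2
      = indicat_real E x *\<^sub>R (cmod (\<Sum>i\<in>F. a i * cis (2 * pi * \<mu> i * x)))\<^sup>2" for x
    using assms by (cases "x \<in> E") (auto simp: restricted_exponential_eq)
  note eq = this
  show ?thesis
    unfolding set_lebesgue_integral_def eq[symmetric]
    by (rule integral_restrict_space) simp
qed

text \<open>
  The energy on \<open>E\<close> is the energy on the circle, at least \<open>1 - \<kappa>\<close> times the sum of the squared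
  coefficients, minus that on the complement, at most the sum of the energies on the covering
  intervals.
\<close>

lemma riesz_sequence_off_small_intervals:
  fixes \<mu> :: "int \<Rightarrow> real" and A :: "nat \<Rightarrow> real set" and N :: real
  assumes E: "E \<in> sets lebesgue" "E \<subseteq> circle" and cover: "circle - E \<subseteq> (\<Union>n. A n)"
    and A: "\<And>n. circle_interval (A n)"
    and L: "summable (\<lambda>n. measure lebesgue (A n))"
    and L\<alpha>: "summable (\<lambda>n. measure lebesgue (A n) powr \<alpha>)"
    and "0 < N" "0 < r" "r < 1 - \<alpha>" "0 < \<alpha>"
    and gap: "\<And>j k. j \<noteq> k \<Longrightarrow> (N * real_of_int \<bar>j - k\<bar>) powr (1 / r) \<le> \<bar>\<mu> j - \<mu> k\<bar>"
  defines "s \<equiv> (1 - \<alpha>) / r"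
  defines "\<kappa> \<equiv> N powr -s * (2 * (\<Sum>n. real n powr -s))"
  assumes small: "(\<Sum>n. measure lebesgue (A n))
      + \<kappa> * (1 + (\<Sum>n. measure lebesgue (A n) powr \<alpha>)) < 1"
  shows "riesz_sequence (lebesgue_on circle) (\<lambda>m. restricted_exponential E (\<mu> m))"
  unfolding riesz_sequence_def
proof (intro conjI allI)
  show "square_integrable (lebesgue_on circle) (restricted_exponential E (\<mu> i))" for i
    using E by (rule square_integrable_restricted_exponential)
  let ?S1 = "\<Sum>n. measure lebesgue (A n)" and ?S\<alpha> = "\<Sum>n. measure lebesgue (A n) powr \<alpha>"
  have "0 \<le> \<kappa>"
  proof -
    have "1 < s" using assms by (simp add: s_def field_simps)
    then have "0 \<le> (\<Sum>n. real n powr -s)" by (intro suminf_nonneg) (auto simp: summable_real_powr_iff)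
    then show ?thesis by (simp add: \<kappa>_def)
  qed
  have bounds: "(1 - ?S1 - \<kappa> * (1 + ?S\<alpha>)) * (\<Sum>i | a i \<noteq> 0. (cmod (a i))\<^sup>2)
      \<le> (LINT x|lebesgue_on circle. (cmod (\<Sum>i | a i \<noteq> 0. a i * restricted_exponential E (\<mu> i) x))\<^sup>2)
    \<and> (LINT x|lebesgue_on circle. (cmod (\<Sum>i | a i \<noteq> 0. a i * restricted_exponential E (\<mu> i) x))\<^sup>2)
      \<le> (1 + \<kappa>) * (\<Sum>i | a i \<noteq> 0. (cmod (a i))\<^sup>2)"
    if fin: "finite {i. a i \<noteq> 0}" for a :: "int \<Rightarrow> complex"
  proof -
    define Q where "Q = (\<Sum>i | a i \<noteq> 0. (cmod (a i))\<^sup>2)"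
    define f where "f x = (cmod (\<Sum>i | a i \<noteq> 0. a i * cis (2 * pi * \<mu> i * x)))\<^sup>2" for x
    define energy where "energy S = (LINT x:S|lebesgue. f x)" for S
    have near: "\<bar>energy S - measure lebesgue S * Q\<bar> \<le> (measure lebesgue S powr \<alpha> * \<kappa>) * Q"
      if "circle_interval S" for S
      unfolding energy_def f_def Q_def \<kappa>_def s_def
      using that fin assms by (intro separated_energy) auto
    have cont: "continuous_on UNIV f" unfolding f_def by (intro continuous_intros)
    have si: "set_integrable lebesgue S f" if "S \<in> sets lebesgue" "S \<subseteq> circle" for S
      using cont that by (rule set_integrable_continuous_circle)
    have "circle = frac ` circle" by (auto simp: frac_eq image_iff frac_lt_1 intro!: bexI)
    then have "circle_interval circle"
      unfolding circle_interval_def by (intro exI[of _ circle]) (auto simp: is_interval_1)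
    from near[OF this] have whole: "\<bar>energy circle - Q\<bar> \<le> \<kappa> * Q" by simp
    have split: "energy circle = energy E + energy (circle - E)"
    proof -
      have "energy (E \<union> (circle - E)) = energy E + energy (circle - E)"
        unfolding energy_def using E by (intro set_integral_Un si) auto
      then show ?thesis using E by (simp add: Un_absorb1 Un_commute)
    qed
    have sums: "(\<lambda>n. (measure lebesgue (A n) + \<kappa> * measure lebesgue (A n) powr \<alpha>) * Q)
        sums ((?S1 + \<kappa> * ?S\<alpha>) * Q)"
      using L L\<alpha> by (intro sums_mult2 sums_add sums_mult summable_sums)
    have "energy (circle - E) \<le> (\<Sum>n. (measure lebesgue (A n) + \<kappa> * measure lebesgue (A n) powr \<alpha>) * Q)"
      unfolding energy_def
    proof (rule set_integral_le_suminf_cover[OF _ cover])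
      show "f \<in> borel_measurable lebesgue"
        using cont by (intro measurable_completion) (simp add: borel_measurable_continuous_onI)
      show "(LINT x:A n|lebesgue. f x) \<le> (measure lebesgue (A n) + \<kappa> * measure lebesgue (A n) powr \<alpha>) * Q" for n
        using near[OF A, of n] unfolding energy_def by (simp add: algebra_simps)
      show "set_integrable lebesgue (A n) f" for n
        using circle_interval_sets[OF A] by (intro si) auto
      show "set_integrable lebesgue (circle - E) f"
        using E by (intro si) auto
    qed (use E circle_interval_sets[OF A] sums in \<open>auto simp: f_def sums_iff\<close>)
    also have "\<dots> = (?S1 + \<kappa> * ?S\<alpha>) * Q" using sums by (simp add: sums_iff)
    finally have compl: "energy (circle - E) \<le> (?S1 + \<kappa> * ?S\<alpha>) * Q" .
    have "0 \<le> energy (circle - E)"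
      unfolding energy_def set_lebesgue_integral_def f_def by (intro integral_nonneg_AE) auto
    then have "(1 - ?S1 - \<kappa> * (1 + ?S\<alpha>)) * Q \<le> energy E \<and> energy E \<le> (1 + \<kappa>) * Q"
      using compl whole split by (auto simp: algebra_simps)
    then show ?thesis
      unfolding integral_restricted_exponential_sum[OF E(2)] energy_def f_def Q_def .
  qed
  have "0 < 1 - ?S1 - \<kappa> * (1 + ?S\<alpha>)" "0 < 1 + \<kappa>" using small \<open>0 \<le> \<kappa>\<close> by auto
  then show "\<exists>K1>0. \<exists>K2>0. \<forall>a :: int \<Rightarrow> complex. finite {i. a i \<noteq> 0} \<longrightarrow>
       K1 * (\<Sum>i | a i \<noteq> 0. (cmod (a i))\<^sup>2)
         \<le> (LINT x|lebesgue_on circle. (cmod (\<Sum>i | a i \<noteq> 0. a i * restricted_exponential E (\<mu> i) x))\<^sup>2) \<and>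
       (LINT x|lebesgue_on circle. (cmod (\<Sum>i | a i \<noteq> 0. a i * restricted_exponential E (\<mu> i) x))\<^sup>2)
         \<le> K2 * (\<Sum>i | a i \<noteq> 0. (cmod (a i))\<^sup>2)"
    using bounds by blast
qed

section \<open>Uniform partition into Riesz sequences\<close>

theorem theorem10:
  fixes E :: "real set" and lam :: "int \<Rightarrow> real" and \<alpha> :: real
    and I :: "nat \<Rightarrow> real set" and Z :: nat
  assumes "E \<subseteq> circle" and "E \<in> sets lebesgue"
    and "strict_mono lam"
    and "0 < \<alpha>" and "\<alpha> < 1"
    and "\<And>n. n \<ge> 1 \<Longrightarrow> circle_interval (I n)"
    and "\<And>n. n \<ge> 1 \<Longrightarrow> measure lebesgue (I (Suc n)) \<le> measure lebesgue (I n)"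
    and "circle - E \<subseteq> (\<Union>n\<in>{1..}. I n)"
    and "summable (\<lambda>n. measure lebesgue (I (Z + 1 + n)) powr \<alpha>)"
    and "(\<Sum>n=1..Z. measure lebesgue (I n))
           + (\<Sum>n. measure lebesgue (I (Z + 1 + n)) powr \<alpha>) < 1"
    and "upper_beurling_dim (range lam) < ennreal (1 - \<alpha>)"
  shows "uniformly_partitionable E lam"
proof -
  (* The given intervals are numbered from 1. *)
  define A where "A n = I (Suc n)" for n
  define L where "L n = measure lebesgue (A n)" for n
  have A: "circle_interval (A n)" for n using assms(6) by (simp add: A_def)
  have L1: "0 \<le> L n" "L n \<le> 1" for n
  proof -
    have "L n \<le> measure lebesgue circle"
      unfolding L_def using circle_interval_sets[OF A]
      by (intro measure_mono_fmeasurable bounded_set_imp_lmeasurable) auto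
    then show "L n \<le> 1" "0 \<le> L n" by (auto simp: L_def)
  qed
  have le: "L n \<le> L n powr \<alpha>" for n
    using powr_mono'[of \<alpha> 1 "L n"] L1[of n] assms(5) by (cases "L n = 0") auto
  have tail: "summable (\<lambda>n. L (n + Z) powr \<alpha>)"
    using assms(9) by (simp add: L_def A_def add_ac)
  then have summ\<alpha>: "summable (\<lambda>n. L n powr \<alpha>)"
    using summable_iff_shift[of "\<lambda>n. L n powr \<alpha>" Z] by simp
  have summ: "summable L"
    by (rule summable_comparison_test'[OF summ\<alpha>, of 0]) (use L1 le in auto)
  have total: "suminf L < 1"
  proof -
    have "suminf L = (\<Sum>n. L (n + Z)) + (\<Sum>n<Z. L n)"
      using summ by (rule suminf_split_initial_segment)
    also have "(\<Sum>n<Z. L n) = (\<Sum>n=1..Z. measure lebesgue (I n))"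
      unfolding L_def A_def
      by (rule sum.reindex_bij_witness[of _ "\<lambda>n. n - 1" Suc]) auto
    also have "(\<Sum>n. L (n + Z)) \<le> (\<Sum>n. L (n + Z) powr \<alpha>)"
      using le tail summ by (intro suminf_le) (auto simp: summable_iff_shift)
    also have "(\<Sum>n. L (n + Z) powr \<alpha>) = (\<Sum>n. measure lebesgue (I (Z + 1 + n)) powr \<alpha>)"
      by (simp add: L_def A_def add_ac)
    finally show ?thesis using assms(10) by simp
  qed
  have cover: "circle - E \<subseteq> (\<Union>n. A n)"
  proof
    fix x assume "x \<in> circle - E"
    then obtain n where "n \<ge> 1" "x \<in> I n" using assms(8) by auto
    then have "x \<in> A (n - 1)" by (simp add: A_def)
    then show "x \<in> (\<Union>n. A n)" by blast
  qed
  obtain z where z: "upper_beurling_dim (range lam) < z" "z < ennreal (1 - \<alpha>)"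
    using dense[OF assms(11)] by blast
  define r where "r = enn2real z"
  have zr: "z = ennreal r"
    unfolding r_def using order.strict_trans[OF z(2) ennreal_less_top] by simp
  have "0 < z" using z(1) by (metis gr_zeroI not_less_zero)
  then have "0 < r" by (simp add: zr)
  then have "r < 1 - \<alpha>" using z(2) by (simp add: zr ennreal_less_iff)
  obtain N0 where N0: "\<And>i j. int N0 \<le> j - i \<Longrightarrow> real_of_int (j - i) powr (1 / r) \<le> lam j - lam i"
    using gap_of_dimension[OF assms(3) z(1)[unfolded zr] \<open>0 < r\<close>] by blast
  define s where "s = (1 - \<alpha>) / r"
  have "0 < s" using \<open>0 < r\<close> assms(5) by (simp add: s_def)
  (* N powr -s * C is the loss \<kappa> * (1 + (\<Sum>n. L n powr \<alpha>)) in the lower Riesz bound. *)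
  define C where "C = (2 * (\<Sum>n. real n powr -s)) * (1 + (\<Sum>n. L n powr \<alpha>))"
  have "(\<lambda>N. real N powr -s * C) \<longlonglongrightarrow> 0 * C"
    using \<open>0 < s\<close> by (intro tendsto_mult_right tendsto_neg_powr filterlim_real_sequentially) auto
  then have "\<forall>\<^sub>F N in sequentially. real N powr -s * C < 1 - suminf L"
    using total by (intro order_tendstoD(2)) auto
  then have "\<forall>\<^sub>F N in sequentially. real N powr -s * C < 1 - suminf L \<and> max 1 N0 \<le> N"
    by (rule eventually_conj[OF _ eventually_ge_at_top])
  then obtain N :: nat where N: "real N powr -s * C < 1 - suminf L" "1 \<le> N" "N0 \<le> N"
    by (auto dest!: eventually_happens)
  show ?thesis
    unfolding uniformly_partitionable_def uniform_riesz_partition_def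
  proof (intro exI[of _ N] conjI ballI)
    fix J assume "J \<in> {1..N}"
    let ?\<mu> = "\<lambda>m. lam (m * int N + int J)"
    have gap1: "(real N * real_of_int \<bar>j - k\<bar>) powr (1 / r) \<le> \<bar>?\<mu> j - ?\<mu> k\<bar>" if "k < j" for j k
    proof -
      have eq: "(j * int N + int J) - (k * int N + int J) = int N * \<bar>j - k\<bar>"
        using that by (simp add: algebra_simps)
      have "int N0 \<le> int N * 1" using N by simp
      also have "\<dots> \<le> int N * \<bar>j - k\<bar>" using that by (intro mult_left_mono) auto
      finally show ?thesis
        using N0[of "j * int N + int J" "k * int N + int J"] unfolding eq by simp
    qed
    have gap: "(real N * real_of_int \<bar>j - k\<bar>) powr (1 / r) \<le> \<bar>?\<mu> j - ?\<mu> k\<bar>" if "j \<noteq> k" for j k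
      using gap1[of j k] gap1[of k j] that by (auto simp: abs_minus_commute neq_iff)
    show "riesz_sequence (lebesgue_on circle) (\<lambda>m. restricted_exponential E (?\<mu> m))"
    proof (rule riesz_sequence_off_small_intervals[OF assms(2,1) cover A _ _ _ \<open>0 < r\<close> \<open>r < 1 - \<alpha>\<close> assms(4) gap])
      show "summable (\<lambda>n. measure lebesgue (A n))" "summable (\<lambda>n. measure lebesgue (A n) powr \<alpha>)"
        using summ summ\<alpha> by (simp_all add: L_def[abs_def])
      show "0 < real N" using N by simp
      show "(\<Sum>n. measure lebesgue (A n)) + real N powr - ((1 - \<alpha>) / r) *
          (2 * (\<Sum>n. real n powr - ((1 - \<alpha>) / r))) * (1 + (\<Sum>n. measure lebesgue (A n) powr \<alpha>)) < 1"
        using N(1) by (simp add: C_def L_def[abs_def] s_def mult_ac)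
    qed
  qed (use N in auto)
qed

end
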